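(* Let $1\le m<n$ and let $\{\varphi_i\}_{i=1}^n$ be a centered or axial ETF for $\mathbb{R}^m$ with synthesis operator $\Phi$. Let $\alpha=\frac nm$ and $\beta=\left[\frac{n-m}{m(n-1)}\right]^{1/2}$. Then $$A=\tfrac1{2\beta}\Phi^*\Phi-\tfrac{\beta+1}{2\beta}I+\tfrac12J$$ is the adjacency matrix of an $\mathrm{SRG}(v,k,\lambda,\mu)$ with $v=4k-2\lambda-2\mu$. In particular, if the ETF is centered, the parameters are $$v=n,\quad k=\tfrac{n-1}{2}-\tfrac1{2\beta},\quad \lambda=\tfrac n4-1+\tfrac{\alpha-4}{4\beta},\quad \mu=\tfrac n4-\tfrac{\alpha}{4\beta},$$ while if the ETF is axial, the parameters are $$v=n,\quad k=\tfrac{n-1}{2}+\tfrac{\alpha-1}{2\beta},\quad \lambda=\tfrac n4-1+\tfrac{3\alpha-4}{4\beta},\quad \mu=\tfrac n4+\tfrac{\alpha}{4\beta}.$$ Moreover, the parameters of the graph complement of the SRG so obtained from a centered (respectively axial) ETF equal the parameters of the SRG so obtained from any of its Naimark complements, which are axial (respectively centered) ETFs for $\mathbb{R}^{n-m}$.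
   Context: For vectors $\{\varphi_i\}_{i=1}^n$ in $\mathbb{R}^m$, the synthesis operator $\Phi$ is the $m\times n$ matrix whose $i$th column is $\varphi_i$. The sequence is an equiangular tight frame (ETF) for $\mathbb{R}^m$ if every $\varphi_i$ has unit norm, $|\langle\varphi_i,\varphi_j\rangle|$ is constant over all $i\neq j$, and $\Phi\Phi^*=\alpha I$ for some $\alpha>0$ (necessarily $\alpha=\frac nm$); the constant value of $|\langle\varphi_i,\varphi_j\rangle|$ is then $\left[\frac{n-m}{m(n-1)}\right]^{1/2}$. Let $\mathbf{1}$ be the all-ones vector and $J=\mathbf{1}\mathbf{1}^*$. An ETF is centered if $\mathbf{1}$ lies in the null space of $\Phi$ (equivalently $\Phi^*\Phi\mathbf{1}=\mathbf{0}$); it is axial if $\mathbf{1}$ lies in the column space of $\Phi^*$ (equivalently $\Phi^*\Phi\mathbf{1}=\alpha\mathbf{1}$). A (real) Naimark complement of an ETF with $m\times n$ synthesis operator $\Phi$, $m<n$, is the sequence of columns of any real $(n-m)\times n$ matrix $\tilde\Phi$ whose rows form an orthogonal basis of the orthogonal complement of the row space of $\Phi$, each row having squared norm $\frac{n}{n-m}$; it is known to be an ETF for $\mathbb{R}^{n-m}$, with $\frac mn\Phi^*\Phi+\frac{n-m}{n}\tilde\Phi^*\tilde\Phi=I$. A simple graph on $v$ vertices with adjacency matrix $A$ is an $\mathrm{SRG}(v,k,\lambda,\mu)$ (strongly regular graph) if it is $k$-regular and $A^2=(\lambda-\mu)A+(k-\mu)I+\mu J$. This algebraic identity is taken as the definition;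 when $A\ne0$ and $A\neq J-I$ it forces $k,\lambda,\mu$ to be nonnegative integers ($k$ = degree, $\lambda$ = number of common neighbors of any two neighbors, $\mu$ = number of common neighbors of any two distinct nonneighbors), while in the two trivial cases $A=0$ and $A=J-I$ the numbers $\lambda,\mu$ are only required to be real numbers satisfying the identity. The graph complement of an $\mathrm{SRG}(v,k,\lambda,\mu)$ has adjacency matrix $J-I-A$ and is regarded as an SRG with parameters $(v,\ v-k-1,\ v-2k-2+\mu,\ v-2k+\lambda)$. *)

theory Defs
  imports "HOL-Analysis.Analysis"
begin

text \<open>
  A sequence of \<open>n\<close> vectors in \<open>m\<close>-dimensional real space is a function \<open>\<phi> :: 'n \<Rightarrow> real^'m\<close> with
  \<open>n = CARD('n)\<close> and \<open>m = CARD('m)\<close>. As usual in HOL-Analysis, \<open>real^'n^'m\<close> is the type of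
  matrices with \<open>CARD('m)\<close> rows and \<open>CARD('n)\<close> columns. On vectors, \<open>1\<close> is the all-ones vector;
  the identity matrix is \<open>mat 1\<close>.
\<close>

definition all_ones :: "real^'n^'n" where
  "all_ones = (\<chi> i j. 1)"


section \<open>Equiangular tight frames\<close>

definition synthesis :: "('n \<Rightarrow> real^'m) \<Rightarrow> real^'n^'m" where
  "synthesis \<phi> = (\<chi> i j. \<phi> j $ i)"

definition gram :: "('n::finite \<Rightarrow> real^'m) \<Rightarrow> real^'n^'n" where
  "gram \<phi> = transpose (synthesis \<phi>) ** synthesis \<phi>"

definition etf :: "('n::finite \<Rightarrow> real^'m) \<Rightarrow> bool" where
  "etf \<phi> \<longleftrightarrow>
     (\<forall>i. norm (\<phi> i) = 1) \<and>
     (\<exists>c. \<forall>i j. i \<noteq> j \<longrightarrow> \<bar>\<phi> i \<bullet> \<phi> j\<bar> = c) \<and>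
     (\<exists>a>0. synthesis \<phi> ** transpose (synthesis \<phi>) = a *\<^sub>R mat 1)"

definition centered :: "('n::finite \<Rightarrow> real^'m) \<Rightarrow> bool" where
  "centered \<phi> \<longleftrightarrow> synthesis \<phi> *v 1 = 0"

definition axial :: "('n::finite \<Rightarrow> real^'m) \<Rightarrow> bool" where
  "axial \<phi> \<longleftrightarrow> 1 \<in> span (columns (transpose (synthesis \<phi>)))"

definition naimark_complement ::
    "('n::finite \<Rightarrow> real^'m) \<Rightarrow> ('n \<Rightarrow> real^'k) \<Rightarrow> bool" where
  "naimark_complement \<phi> \<psi> \<longleftrightarrow>
     CARD('m) < CARD('n) \<and> CARD('k) = CARD('n) - CARD('m) \<and>
     pairwise (\<lambda>i j. orthogonal (row i (synthesis \<psi>)) (row j (synthesis \<psi>))) UNIV \<and>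
     independent (rows (synthesis \<psi>)) \<and>
     span (rows (synthesis \<psi>)) = (span (rows (synthesis \<phi>)))\<^sup>\<bottom> \<and>
     (\<forall>i. (norm (row i (synthesis \<psi>)))\<^sup>2 = real CARD('n) / (real CARD('n) - real CARD('m)))"


section \<open>Strongly regular graphs\<close>

text \<open>Graphs are adjacency relations whose vertex set is the whole (finite) type.\<close>

definition simple_graph :: "('v \<Rightarrow> 'v \<Rightarrow> bool) \<Rightarrow> bool" where
  "simple_graph E \<longleftrightarrow> symp E \<and> irreflp E"

definition adjacency_matrix :: "('v \<Rightarrow> 'v \<Rightarrow> bool) \<Rightarrow> real^'v^'v" where
  "adjacency_matrix E = (\<chi> i j. if E i j then 1 else 0)"

definition graph_complement :: "('v \<Rightarrow> 'v \<Rightarrow> bool) \<Rightarrow> 'v \<Rightarrow> 'v \<Rightarrow> bool" where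
  "graph_complement E = (\<lambda>i j. i \<noteq> j \<and> \<not> E i j)"

type_synonym srg_params = "real \<times> real \<times> real \<times> real"

text \<open>
  The parameters \<open>(v, k, \<lambda>, \<mu>)\<close> are real numbers. The conditions below force \<open>v\<close> and \<open>k\<close> to be
  natural numbers, but for empty and complete graphs \<open>\<lambda>\<close> and \<open>\<mu>\<close> are not determined by the graph
  and need not be integers. In the code, \<open>l\<close> is \<open>\<lambda>\<close> and \<open>u\<close> is \<open>\<mu>\<close>.
\<close>

fun srg :: "('v::finite \<Rightarrow> 'v \<Rightarrow> bool) \<Rightarrow> srg_params \<Rightarrow> bool" where
  "srg E (v, k, l, u) \<longleftrightarrow>
     simple_graph E \<and> v = real CARD('v) \<and>
     (\<forall>i. real (card {j. E i j}) = k) \<and>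
     adjacency_matrix E ** adjacency_matrix E =
       (l - u) *\<^sub>R adjacency_matrix E + (k - u) *\<^sub>R mat 1 + u *\<^sub>R all_ones"

fun complement_params :: "srg_params \<Rightarrow> srg_params" where
  "complement_params (v, k, l, u) = (v, v - k - 1, v - 2 * k - 2 + u, v - 2 * k + l)"


section \<open>From equiangular tight frames to strongly regular graphs\<close>

text \<open>In the following, \<open>m\<close> is the dimension and \<open>n\<close> the number of vectors.\<close>

definition etf_alpha :: "nat \<Rightarrow> nat \<Rightarrow> real" where
  "etf_alpha m n = real n / real m"

definition etf_beta :: "nat \<Rightarrow> nat \<Rightarrow> real" where
  "etf_beta m n = sqrt ((real n - real m) / (real m * (real n - 1)))"

definition etf_matrix :: "('n::finite \<Rightarrow> real^'m) \<Rightarrow> real^'n^'n" where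
  "etf_matrix \<phi> =
     (let \<beta> = etf_beta CARD('m) CARD('n)
      in (1 / (2 * \<beta>)) *\<^sub>R gram \<phi> - ((\<beta> + 1) / (2 * \<beta>)) *\<^sub>R mat 1 + (1 / 2) *\<^sub>R all_ones)"

definition centered_params :: "nat \<Rightarrow> nat \<Rightarrow> srg_params" where
  "centered_params m n =
     (let \<alpha> = etf_alpha m n; \<beta> = etf_beta m n
      in (real n,
          (real n - 1) / 2 - 1 / (2 * \<beta>),
          real n / 4 - 1 + (\<alpha> - 4) / (4 * \<beta>),
          real n / 4 - \<alpha> / (4 * \<beta>)))"

definition axial_params :: "nat \<Rightarrow> nat \<Rightarrow> srg_params" where
  "axial_params m n =
     (let \<alpha> = etf_alpha m n; \<beta> = etf_beta m n
      in (real n,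
          (real n - 1) / 2 + (\<alpha> - 1) / (2 * \<beta>),
          real n / 4 - 1 + (3 * \<alpha> - 4) / (4 * \<beta>),
          real n / 4 + \<alpha> / (4 * \<beta>)))"

end

(* For an ETF with gram matrix G we have G ** G = \<alpha> G, and its off-diagonal entries are \<plusminus>\<beta>; hence
   etf_matrix has entries 0 and 1 and a zero diagonal. Both centered and axial ETFs satisfy
   G *v 1 = s 1, with s = 0 respectively s = \<alpha>, and every such s gives a strongly regular graph by
   expanding the square of a linear combination of G, I and J. For a Naimark complement with gram
   matrix H one has G / \<alpha> + H / \<alpha>' = I, so its graph is the complementary one and its eigenvalue
   is s' = \<alpha>' (1 - s / \<alpha>). *)

theory Submission
  imports Defs
begin

section \<open>Gram matrices of tight frames: the row space and its orthogonal complement\<close>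

lemma gram_component: "gram \<phi> $ i $ j = \<phi> i \<bullet> \<phi> j"
  by (simp add: gram_def synthesis_def matrix_matrix_mult_def transpose_def inner_vec_def)

lemma transpose_gram: "transpose (gram \<phi>) = gram \<phi>"
  by (simp add: gram_def matrix_transpose_mul transpose_transpose)

lemma mult_transpose_component: "(A ** transpose A) $ i $ j = row i A \<bullet> row j (A :: real^'n^'m)"
  by (simp add: matrix_matrix_mult_def transpose_def row_def inner_vec_def)

text \<open>Reassociating the product brings \<open>?S ** transpose ?S\<close> to the middle, where
  tightness turns it into a scalar.\<close>

lemma gram_square:
  assumes "synthesis \<phi> ** transpose (synthesis \<phi>) = a *\<^sub>R mat 1"
  shows "gram \<phi> ** gram \<phi> = a *\<^sub>R gram \<phi>"
proof -
  let ?S = "synthesis \<phi>"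
  have "gram \<phi> ** gram \<phi> = transpose ?S ** (?S ** transpose ?S) ** ?S"
    by (simp add: gram_def matrix_mul_assoc)
  also have "\<dots> = a *\<^sub>R gram \<phi>"
    by (simp add: assms gram_def matrix_scalar_ac scalar_matrix_assoc[symmetric] flip: scalar_mult_eq_scaleR)
  finally show ?thesis .
qed

text \<open>Tightness makes every vector \<open>transpose ?S *v y\<close> an eigenvector for
  \<open>a\<close>. The rows have this form, with \<open>y\<close> a basis vector, and the
  eigenvectors for \<open>a\<close> together with 0 form a subspace.\<close>

lemma gram_row_space:
  assumes tight: "synthesis \<phi> ** transpose (synthesis \<phi>) = a *\<^sub>R mat 1"
    and "x \<in> span (rows (synthesis \<phi>))"
  shows "gram \<phi> *v x = a *\<^sub>R x"
proof -
  let ?S = "synthesis \<phi>"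
  have "rows ?S \<subseteq> {x. gram \<phi> *v x = a *\<^sub>R x}"
  proof
    fix x assume "x \<in> rows ?S"
    then obtain i where "x = transpose ?S *v axis i 1"
      by (auto simp: rows_def simp flip: column_transpose matrix_vector_mult_basis)
    moreover have "gram \<phi> *v (transpose ?S *v y) = a *\<^sub>R (transpose ?S *v y)" for y
    proof -
      have "gram \<phi> *v (transpose ?S *v y) = transpose ?S *v ((?S ** transpose ?S) *v y)"
        by (simp add: gram_def matrix_vector_mul_assoc matrix_mul_assoc del: transpose_matrix_vector)
      then show ?thesis
        by (simp add: tight scaleR_matrix_vector_assoc[symmetric] matrix_vector_mult_scaleR)
    qed
    ultimately show "x \<in> {x. gram \<phi> *v x = a *\<^sub>R x}" by simp
  qed
  moreover have "subspace {x. gram \<phi> *v x = a *\<^sub>R x}"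
    by (auto simp: subspace_def matrix_vector_right_distrib matrix_vector_mult_scaleR scaleR_add_right)
  ultimately show ?thesis
    using span_minimal assms(2) by blast
qed

text \<open>The entries of \<open>A *v x\<close> are the inner products of \<open>x\<close> with the
  rows, and orthogonality to the rows extends to their span. This turns \<open>centered\<close> into
  a statement about the row space, as \<open>axial\<close> already is.\<close>

lemma matrix_mult_eq_0_iff_orthogonal:
  fixes A :: "real^'n^'m"
  shows "A *v x = 0 \<longleftrightarrow> x \<in> (span (rows A))\<^sup>\<bottom>"
proof -
  have "A *v x = 0 \<longleftrightarrow> (\<forall>y\<in>rows A. orthogonal x y)"
    by (auto simp: vec_eq_iff[of "A *v x"] matrix_vector_mul_component rows_def row_def
        orthogonal_def inner_commute)
  also have "\<dots> \<longleftrightarrow> (\<forall>y\<in>span (rows A). orthogonal x y)"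
    using orthogonal_to_span span_base by blast
  finally show ?thesis
    by (auto simp: orthogonal_comp_def orthogonal_commute)
qed

lemma gram_eq_0:
  assumes "x \<in> (span (rows (synthesis \<phi>)))\<^sup>\<bottom>"
  shows "gram \<phi> *v x = 0"
  using assms
  by (simp add: gram_def matrix_vector_mul_assoc[symmetric] flip: matrix_mult_eq_0_iff_orthogonal)

section \<open>The frame constant \<alpha> and the common angle \<beta>\<close>

lemma etf_alpha_gt_1: "m < n \<Longrightarrow> 0 < m \<Longrightarrow> etf_alpha m n > 1"
  by (simp add: etf_alpha_def)

lemma etf_beta_pos: "m < n \<Longrightarrow> 0 < m \<Longrightarrow> etf_beta m n > 0"
  by (simp add: etf_beta_def)

text \<open>This relation identifies the unknown angle of an ETF with \<beta>, and later eliminates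
  \<open>n\<close> from the parameter identities.\<close>

lemma etf_beta_square:
  assumes "m < n" "0 < m"
  shows "(real n - 1) * (etf_beta m n)\<^sup>2 = etf_alpha m n - 1"
  using assms by (simp add: etf_beta_def etf_alpha_def field_simps)

text \<open>The trace of \<open>?S ** transpose ?S\<close> is computed twice: it is the sum of the
  squared norms of the \<open>n\<close> unit vectors, and it is \<open>a\<close> times the
  dimension.\<close>

lemma etf_tight:
  fixes \<phi> :: "'n::finite \<Rightarrow> real^'m::finite"
  assumes "etf \<phi>"
  shows "synthesis \<phi> ** transpose (synthesis \<phi>) = etf_alpha CARD('m) CARD('n) *\<^sub>R mat 1"
proof -
  let ?S = "synthesis \<phi>"
  obtain a where a: "?S ** transpose ?S = a *\<^sub>R mat 1"
    using assms by (auto simp: etf_def)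
  have "real CARD('n) = (\<Sum>j\<in>UNIV. \<phi> j \<bullet> \<phi> j)"
    using assms by (simp add: etf_def dot_square_norm)
  also have "\<dots> = (\<Sum>i\<in>UNIV. (?S ** transpose ?S) $ i $ i)"
    unfolding inner_vec_def
    by (subst sum.swap) (simp add: matrix_matrix_mult_def transpose_def synthesis_def)
  also have "\<dots> = a * real CARD('m)"
    by (simp add: a mat_def)
  finally show ?thesis
    using a by (simp add: etf_alpha_def)
qed

text \<open>Comparing a diagonal entry on both sides of G ** G = \<alpha> G gives \<alpha> = 1 + (n
  - 1) c^2 for the unknown angle \<open>c\<close>, so \<open>c\<close> and \<beta> have the same
  square.\<close>

lemma etf_inner:
  fixes \<phi> :: "'n::finite \<Rightarrow> real^'m::finite"
  assumes lt: "CARD('m) < CARD('n)" and "etf \<phi>" and "i \<noteq> j"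
  shows "\<bar>\<phi> i \<bullet> \<phi> j\<bar> = etf_beta CARD('m) CARD('n)"
proof -
  let ?a = "etf_alpha CARD('m) CARD('n)" and ?b = "etf_beta CARD('m) CARD('n)"
  obtain c where c: "\<And>i j. i \<noteq> j \<Longrightarrow> \<bar>\<phi> i \<bullet> \<phi> j\<bar> = c"
    using assms(2) by (auto simp: etf_def)
  have unit: "\<phi> i \<bullet> \<phi> i = 1"
    using assms(2) by (simp add: etf_def dot_square_norm)
  have "?a = (?a *\<^sub>R gram \<phi>) $ i $ i"
    by (simp add: gram_component unit)
  also have "\<dots> = (gram \<phi> ** gram \<phi>) $ i $ i"
    by (simp add: gram_square[OF etf_tight[OF assms(2)]])
  also have "\<dots> = (\<Sum>l\<in>UNIV. (\<phi> i \<bullet> \<phi> l)\<^sup>2)"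
    by (simp add: matrix_matrix_mult_def gram_component power2_eq_square inner_commute)
  also have "\<dots> = 1 + (\<Sum>l\<in>UNIV - {i}. (\<phi> i \<bullet> \<phi> l)\<^sup>2)"
    by (simp add: sum.remove[of UNIV i] unit)
  also have "(\<Sum>l\<in>UNIV - {i}. (\<phi> i \<bullet> \<phi> l)\<^sup>2) = (\<Sum>l\<in>UNIV - {i}. c\<^sup>2)"
    by (intro sum.cong refl) (metis Diff_iff c insertI1 power2_abs)
  also have "\<dots> = (real CARD('n) - 1) * c\<^sup>2"
    using lt by (simp add: of_nat_diff)
  finally have "(real CARD('n) - 1) * c\<^sup>2 = (real CARD('n) - 1) * ?b\<^sup>2"
    using etf_beta_square[OF lt zero_less_card_finite] by linarith
  moreover have "CARD('n) > 1"
    using lt zero_less_card_finite[where 'a='m] by linarith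
  ultimately have "c\<^sup>2 = ?b\<^sup>2"
    by simp
  \<comment> \<open>The sign of \<open>c\<close> is known only because the pair \<open>i\<close>,
    \<open>j\<close> of distinct indices exhibits it as an absolute value.\<close>
  moreover have "c \<ge> 0"
    using c[OF \<open>i \<noteq> j\<close>] by linarith
  ultimately show ?thesis
    using etf_beta_pos[OF lt] c[OF \<open>i \<noteq> j\<close>] by (simp add: power2_eq_iff_nonneg)
qed

section \<open>The graph of an ETF and its adjacency matrix\<close>

definition etf_graph :: "('n::finite \<Rightarrow> real^'m::finite) \<Rightarrow> 'n \<Rightarrow> 'n \<Rightarrow> bool" where
  "etf_graph \<phi> = (\<lambda>i j. i \<noteq> j \<and> \<phi> i \<bullet> \<phi> j > 0)"

text \<open>Here \<open>s\<close> stands for the eigenvalue of the Gram matrix at the all-ones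
  vector. The value 0 gives \<open>centered_params\<close> and the value \<alpha> gives
  \<open>axial_params\<close>, so both cases share one computation.\<close>

definition etf_params :: "nat \<Rightarrow> nat \<Rightarrow> real \<Rightarrow> srg_params" where
  "etf_params m n s =
     (let \<alpha> = etf_alpha m n; \<beta> = etf_beta m n
      in (real n,
          (real n - 1) / 2 + (s - 1) / (2 * \<beta>),
          real n / 4 - 1 + (\<alpha> + 2 * s - 4) / (4 * \<beta>),
          real n / 4 + (2 * s - \<alpha>) / (4 * \<beta>)))"

lemma etf_matrix_component:
  fixes \<phi> :: "'n::finite \<Rightarrow> real^'m::finite"
  defines "\<beta> \<equiv> etf_beta CARD('m) CARD('n)"
  shows "etf_matrix \<phi> $ i $ j =
    \<phi> i \<bullet> \<phi> j / (2 * \<beta>) - (if i = j then (\<beta> + 1) / (2 * \<beta>) else 0) + 1 / 2"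
  by (simp add: etf_matrix_def Let_def gram_component mat_def all_ones_def \<beta>_def)

text \<open>On the diagonal the three terms cancel. Off it the inner product is \<beta> or -\<beta>,
  so the entry is 1/2 + 1/2 or -1/2 + 1/2.\<close>

lemma etf_matrix_eq_adjacency_matrix:
  fixes \<phi> :: "'n::finite \<Rightarrow> real^'m::finite"
  assumes lt: "CARD('m) < CARD('n)" and etf: "etf \<phi>"
  shows "etf_matrix \<phi> = adjacency_matrix (etf_graph \<phi>)"
proof -
  let ?b = "etf_beta CARD('m) CARD('n)"
  have b: "?b > 0"
    using etf_beta_pos[OF lt] by simp
  have unit: "\<phi> i \<bullet> \<phi> i = 1" for i
    using etf by (simp add: etf_def dot_square_norm)
  have "etf_matrix \<phi> $ i $ j = adjacency_matrix (etf_graph \<phi>) $ i $ j" for i j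
  proof (cases "i = j")
    case True
    with b show ?thesis
      by (simp add: etf_matrix_component adjacency_matrix_def etf_graph_def unit field_simps)
  next
    case False
    then have "\<phi> i \<bullet> \<phi> j = ?b \<or> \<phi> i \<bullet> \<phi> j = - ?b"
      using etf_inner[OF lt etf False] by linarith
    with False b show ?thesis
      by (auto simp: etf_matrix_component adjacency_matrix_def etf_graph_def)
  qed
  then show ?thesis
    by (simp add: vec_eq_iff)
qed

section \<open>Squares of linear combinations of G, I and J\<close>

lemma mult_all_ones: "A *v 1 = s *\<^sub>R 1 \<Longrightarrow> A ** all_ones = s *\<^sub>R (all_ones :: real^'n^'n)"
  by (simp add: vec_eq_iff matrix_matrix_mult_def matrix_vector_mult_def all_ones_def)

lemma all_ones_mult:
  assumes "transpose A *v 1 = s *\<^sub>R 1"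
  shows "all_ones ** A = s *\<^sub>R (all_ones :: real^'n^'n)"
  using assms
  by (simp add: vec_eq_iff matrix_matrix_mult_def matrix_vector_mult_def all_ones_def transpose_def)

lemma all_ones_square: "all_ones ** all_ones = real CARD('n) *\<^sub>R (all_ones :: real^'n^'n)"
  by (simp add: vec_eq_iff matrix_matrix_mult_def all_ones_def)

text \<open>The span of G, I and J is closed under products: G ** G = a G, G ** J = J ** G = s J and
  J ** J = n J. Symmetry of G supplies the product with J on the left.\<close>

lemma linear_combination_square:
  fixes G :: "real^'n^'n"
  assumes "G ** G = a *\<^sub>R G" and "G *v 1 = s *\<^sub>R 1" and "transpose G = G"
  shows "(x *\<^sub>R G - y *\<^sub>R mat 1 + z *\<^sub>R all_ones) ** (x *\<^sub>R G - y *\<^sub>R mat 1 + z *\<^sub>R all_ones) =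
    (x\<^sup>2 * a - 2 * x * y) *\<^sub>R G + y\<^sup>2 *\<^sub>R mat 1
      + (2 * x * z * s - 2 * y * z + z\<^sup>2 * real CARD('n)) *\<^sub>R all_ones"
proof -
  have GJ: "G ** all_ones = s *\<^sub>R all_ones" "all_ones ** G = s *\<^sub>R all_ones"
    using mult_all_ones[of G s] all_ones_mult[of G s] assms by simp_all
  have sc: "(c *\<^sub>R A) ** B = c *\<^sub>R (A ** B)" "A ** (c *\<^sub>R B) = c *\<^sub>R (A ** B)"
    for c and A B :: "real^'n^'n"
    by (simp_all add: vec_eq_iff matrix_matrix_mult_def sum_distrib_left mult_ac)
  have dist: "(A + B) ** C = A ** C + B ** C" for A B C :: "real^'n^'n"
    by (simp add: vec_eq_iff matrix_matrix_mult_def sum.distrib distrib_right)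
  \<comment> \<open>Writing the difference as a sum lets the rules for sums and scalars expand the
    whole product.\<close>
  have diff: "A - B = A + (-1) *\<^sub>R B" for A B :: "real^'n^'n"
    by simp
  show ?thesis
    unfolding diff matrix_add_ldistrib dist sc assms(1) GJ all_ones_square
      matrix_mul_lid matrix_mul_rid
    by (simp add: vec_eq_iff algebra_simps power2_eq_square)
qed

text \<open>The adjacency matrix is x G - y I + J/2. The first three identities match the
  coefficients of G, I and J in the equation for its square, and the fourth gives its row
  sums.\<close>

lemma etf_params_identity:
  assumes "m < n" "0 < m" "etf_params m n s = (v, k, l, u)"
  defines "x \<equiv> 1 / (2 * etf_beta m n)" and "y \<equiv> (etf_beta m n + 1) / (2 * etf_beta m n)"
  shows "x\<^sup>2 * etf_alpha m n - 2 * x * y = (l - u) * x"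
    and "y\<^sup>2 = (k - u) - (l - u) * y"
    and "x * s - y + real n / 4 = (l - u) / 2 + u"
    and "k = x * s - y + real n / 2"
    and "v = 4 * k - 2 * l - 2 * u"
proof -
  define a b where "a = etf_alpha m n" and "b = etf_beta m n"
  have b: "b > 0" and n: "real n = 1 + (a - 1) / b\<^sup>2"
    using etf_beta_pos[OF assms(1,2)] etf_beta_square[OF assms(1,2)]
    by (auto simp: a_def b_def field_simps)
  have p: "v = real n" "k = (real n - 1) / 2 + (s - 1) / (2 * b)"
    "l = real n / 4 - 1 + (a + 2 * s - 4) / (4 * b)"
    "u = real n / 4 + (2 * s - a) / (4 * b)"
    using assms(3) by (auto simp: etf_params_def Let_def a_def b_def)
  show "x\<^sup>2 * etf_alpha m n - 2 * x * y = (l - u) * x"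
    "x * s - y + real n / 4 = (l - u) / 2 + u"
    "k = x * s - y + real n / 2"
    "v = 4 * k - 2 * l - 2 * u"
    using b unfolding p x_def y_def a_def[symmetric] b_def[symmetric]
    by (simp_all add: field_simps power2_eq_square)
  \<comment> \<open>Among these identities, the coefficient of I is where \<open>n\<close> must be
    expressed through \<alpha> and \<beta>.\<close>
  show "y\<^sup>2 = (k - u) - (l - u) * y"
    using b unfolding p x_def y_def a_def[symmetric] b_def[symmetric] n
    by (simp add: field_simps power2_eq_square)
qed

section \<open>Strong regularity and the centered and axial parameters\<close>

lemma adjacency_matrix_mult_one:
  "(adjacency_matrix E *v 1) $ i = real (card {j. E i j})" for E :: "'n::finite \<Rightarrow> 'n \<Rightarrow> bool"
  by (simp add: adjacency_matrix_def matrix_vector_mult_def sum.If_cases)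

lemma srg_etf_graph:
  fixes \<phi> :: "'n::finite \<Rightarrow> real^'m::finite"
  assumes lt: "CARD('m) < CARD('n)" and etf: "etf \<phi>" and s: "gram \<phi> *v 1 = s *\<^sub>R 1"
  shows "srg (etf_graph \<phi>) (etf_params CARD('m) CARD('n) s)"
proof -
  obtain v k l u where p: "etf_params CARD('m) CARD('n) s = (v, k, l, u)"
    by (metis prod_cases4)
  define x y where "x = 1 / (2 * etf_beta CARD('m) CARD('n))"
    and "y = (etf_beta CARD('m) CARD('n) + 1) / (2 * etf_beta CARD('m) CARD('n))"
  note id = etf_params_identity[OF lt zero_less_card_finite p, folded x_def y_def]
  let ?A = "adjacency_matrix (etf_graph \<phi>)"
  have A: "?A = x *\<^sub>R gram \<phi> - y *\<^sub>R mat 1 + (1/2) *\<^sub>R all_ones"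
    by (simp add: etf_matrix_eq_adjacency_matrix[OF lt etf, symmetric] etf_matrix_def Let_def
        x_def y_def)
  have ones: "all_ones *v 1 = real CARD('n) *\<^sub>R (1 :: real^'n)"
    by (simp add: vec_eq_iff all_ones_def matrix_vector_mult_def)
  \<comment> \<open>Regularity is read off from the all-ones vector being an eigenvector: the
    entries of \<open>?A *v 1\<close> are the vertex degrees.\<close>
  have "?A *v 1 = k *\<^sub>R 1"
    unfolding A matrix_vector_mult_add_rdistrib matrix_vector_mult_diff_rdistrib
      scaleR_matrix_vector_assoc[symmetric] s ones
    by (simp add: vec_eq_iff id(4))
  then have "\<forall>i. real (card {j. etf_graph \<phi> i j}) = k"
    by (simp flip: adjacency_matrix_mult_one)
  moreover have "?A ** ?A = (l - u) *\<^sub>R ?A + (k - u) *\<^sub>R mat 1 + u *\<^sub>R all_ones"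
  proof -
    have "?A ** ?A = ((l - u) * x) *\<^sub>R gram \<phi> + ((k - u) - (l - u) * y) *\<^sub>R mat 1
        + ((l - u) / 2 + u) *\<^sub>R all_ones"
      unfolding A linear_combination_square[OF gram_square[OF etf_tight[OF etf]] s transpose_gram]
        id(1-3)[symmetric]
      by (simp add: power2_eq_square)
    then show ?thesis
      unfolding A by (simp add: vec_eq_iff algebra_simps)
  qed
  moreover have "simple_graph (etf_graph \<phi>)"
    by (auto simp: simple_graph_def etf_graph_def symp_def irreflp_def inner_commute)
  moreover have "v = real CARD('n)"
    using p by (simp add: etf_params_def Let_def)
  ultimately show ?thesis
    by (simp add: p)
qed

lemma centered_gram: "centered \<phi> \<Longrightarrow> gram \<phi> *v 1 = 0"
  by (simp add: centered_def gram_def flip: matrix_vector_mul_assoc)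

lemma axial_gram:
  fixes \<phi> :: "'n::finite \<Rightarrow> real^'m::finite"
  assumes "etf \<phi>" "axial \<phi>"
  shows "gram \<phi> *v 1 = etf_alpha CARD('m) CARD('n) *\<^sub>R 1"
  using assms gram_row_space[OF etf_tight] by (simp add: axial_def columns_transpose)

text \<open>Since the all-ones vector is nonzero, its eigenvalue \<open>s\<close> is unique, hence 0
  for a centered frame and \<alpha> for an axial one.\<close>

lemma etf_params_centered_axial:
  fixes \<phi> :: "'n::finite \<Rightarrow> real^'m::finite"
  assumes "etf \<phi>" "gram \<phi> *v 1 = s *\<^sub>R 1"
  shows "centered \<phi> \<Longrightarrow> etf_params CARD('m) CARD('n) s = centered_params CARD('m) CARD('n)"
    and "axial \<phi> \<Longrightarrow> etf_params CARD('m) CARD('n) s = axial_params CARD('m) CARD('n)"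
proof -
  have eq: "s = t" if "gram \<phi> *v 1 = t *\<^sub>R 1" for t
    using that assms(2) by (simp add: vec_eq_iff)
  show "etf_params CARD('m) CARD('n) s = centered_params CARD('m) CARD('n)" if "centered \<phi>"
    using eq[of 0] centered_gram[OF that]
    by (simp add: etf_params_def centered_params_def Let_def diff_divide_distrib)
  show "etf_params CARD('m) CARD('n) s = axial_params CARD('m) CARD('n)" if "axial \<phi>"
    using eq axial_gram[OF assms(1) that] by (simp add: etf_params_def axial_params_def Let_def)
qed

section \<open>Parameters under complementation\<close>

lemma etf_beta_complement:
  assumes "m < n" "0 < m"
  shows "etf_beta (n - m) n = etf_beta m n / (etf_alpha m n - 1)"
proof (rule power2_eq_imp_eq)
  have "n > 1"
    using assms by simp
  \<comment> \<open>As \<alpha> - 1 = (n - m) / m, both squares equal m / ((n - m) (n - 1)).\<close>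
  then show "(etf_beta (n - m) n)\<^sup>2 = (etf_beta m n / (etf_alpha m n - 1))\<^sup>2"
    using assms
    by (simp add: etf_beta_def etf_alpha_def of_nat_diff power_divide divide_simps)
       (simp add: algebra_simps power2_eq_square)
  show "0 \<le> etf_beta (n - m) n"
    using etf_beta_pos[of "n - m" n] assms by simp
  show "0 \<le> etf_beta m n / (etf_alpha m n - 1)"
    using etf_beta_pos etf_alpha_gt_1 assms by (simp add: less_imp_le)
qed

text \<open>With \<alpha>' = \<alpha> / (\<alpha> - 1) and \<beta>' = \<beta> / (\<alpha> - 1) this
  is a rational identity, valid for every \<open>s\<close>. The new eigenvalue is \<alpha>' for
  \<open>s\<close> = 0 and 0 for \<open>s\<close> = \<alpha>, so the centered and axial cases are
  exchanged.\<close>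

lemma complement_etf_params:
  assumes "m < n" "0 < m"
  shows "complement_params (etf_params m n s) =
    etf_params (n - m) n (etf_alpha (n - m) n * (1 - s / etf_alpha m n))"
proof -
  define a b where "a = etf_alpha m n" and "b = etf_beta m n"
  have ab: "a > 1" "b > 0"
    using assms by (simp_all add: a_def b_def etf_alpha_gt_1 etf_beta_pos)
  have a': "etf_alpha (n - m) n = a / (a - 1)"
    using assms by (simp add: a_def etf_alpha_def of_nat_diff field_simps)
  show ?thesis
    unfolding etf_params_def Let_def a' etf_beta_complement[OF assms] a_def[symmetric] b_def[symmetric]
    using ab by (simp add: divide_simps) (simp add: algebra_simps)
qed

section \<open>Naimark complements of ETFs and their graphs\<close>

lemma naimark_complement_tight:
  fixes \<phi> :: "'n::finite \<Rightarrow> real^'m::finite" and \<psi> :: "'n \<Rightarrow> real^'k::finite"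
  assumes "naimark_complement \<phi> \<psi>"
  shows "synthesis \<psi> ** transpose (synthesis \<psi>) = etf_alpha CARD('k) CARD('n) *\<^sub>R mat 1"
proof -
  \<comment> \<open>The prescribed squared row norm n / (n - m) is the constant \<alpha> for
    dimension n - m.\<close>
  have "row i (synthesis \<psi>) \<bullet> row j (synthesis \<psi>) =
      (if i = j then etf_alpha CARD('k) CARD('n) else 0)" for i j
    using assms
    by (auto simp: naimark_complement_def pairwise_def orthogonal_def dot_square_norm etf_alpha_def
        of_nat_diff)
  then show ?thesis
    by (simp add: vec_eq_iff mult_transpose_component mat_def)
qed

text \<open>Both sides act as 0 on the row space of \<phi> and as the scalar \<alpha>' on its
  orthogonal complement, and these two subspaces together span the whole space.\<close>

lemma naimark_complement_gram:
  fixes \<phi> :: "'n::finite \<Rightarrow> real^'m::finite" and \<psi> :: "'n \<Rightarrow> real^'k::finite"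
  assumes "etf \<phi>" "naimark_complement \<phi> \<psi>"
  shows "gram \<psi> = etf_alpha CARD('k) CARD('n) *\<^sub>R
    (mat 1 - (1 / etf_alpha CARD('m) CARD('n)) *\<^sub>R gram \<phi>)"
proof -
  define a b where "a = etf_alpha CARD('m) CARD('n)" and "b = etf_alpha CARD('k) CARD('n)"
  let ?R = "span (rows (synthesis \<phi>))"
  have R: "span (rows (synthesis \<psi>)) = ?R\<^sup>\<bottom>"
    using assms(2) by (simp add: naimark_complement_def)
  have a: "a \<noteq> 0"
    by (simp add: a_def etf_alpha_def)
  have "gram \<psi> *v x = (b *\<^sub>R (mat 1 - (1 / a) *\<^sub>R gram \<phi>)) *v x" for x
  proof -
    have "x \<in> ?R + ?R\<^sup>\<bottom>"
      by (simp add: subspace_sum_orthogonal_comp)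
    then obtain y z where x: "x = y + z" and y: "y \<in> ?R" and z: "z \<in> ?R\<^sup>\<bottom>"
      by (rule set_plus_elim)
    \<comment> \<open>The row space of \<psi> is \<open>?R\<^sup>\<bottom>\<close>, so membership in
      the double complement is what makes \<open>gram \<psi>\<close> annihilate
      \<open>y\<close>.\<close>
    have "y \<in> (?R\<^sup>\<bottom>)\<^sup>\<bottom>"
      using y by (simp add: orthogonal_comp_self)
    then have "gram \<psi> *v y = 0"
      using gram_eq_0[of y \<psi>] R by simp
    moreover have "gram \<psi> *v z = b *\<^sub>R z"
      using gram_row_space[OF naimark_complement_tight[OF assms(2)]] z R by (simp add: b_def)
    moreover have "gram \<phi> *v y = a *\<^sub>R y"
      using gram_row_space[OF etf_tight[OF assms(1)] y] by (simp add: a_def)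
    ultimately show ?thesis
      using a gram_eq_0[OF z]
      by (simp add: x matrix_vector_right_distrib scaleR_matrix_vector_assoc[symmetric]
          matrix_vector_mult_diff_rdistrib)
  qed
  then show ?thesis
    by (simp add: matrix_eq a_def b_def)
qed

lemma naimark_complement_inner:
  fixes \<phi> :: "'n::finite \<Rightarrow> real^'m::finite" and \<psi> :: "'n \<Rightarrow> real^'k::finite"
  assumes "etf \<phi>" "naimark_complement \<phi> \<psi>"
  shows "\<psi> i \<bullet> \<psi> j = etf_alpha CARD('k) CARD('n) *
    ((if i = j then 1 else 0) - \<phi> i \<bullet> \<phi> j / etf_alpha CARD('m) CARD('n))"
  using arg_cong[OF naimark_complement_gram[OF assms], of "\<lambda>A. A $ i $ j"]
  by (simp add: gram_component mat_def)

text \<open>The diagonal entries are \<alpha>' (1 - 1/\<alpha>) = 1, and the others are those of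
  \<open>gram \<phi>\<close> rescaled by -\<alpha>'/\<alpha>, so their absolute values stay
  constant.\<close>

lemma naimark_complement_etf:
  fixes \<phi> :: "'n::finite \<Rightarrow> real^'m::finite" and \<psi> :: "'n \<Rightarrow> real^'k::finite"
  assumes etf: "etf \<phi>" and nc: "naimark_complement \<phi> \<psi>"
  shows "etf \<psi>"
proof -
  let ?a = "etf_alpha CARD('m) CARD('n)" and ?b = "etf_alpha CARD('k) CARD('n)"
  have cards: "CARD('m) < CARD('n)" "CARD('k) = CARD('n) - CARD('m)"
    using nc by (simp_all add: naimark_complement_def)
  have "norm (\<psi> i) = 1" for i
  proof -
    have "\<phi> i \<bullet> \<phi> i = 1"
      using etf by (simp add: etf_def dot_square_norm)
    then have "\<psi> i \<bullet> \<psi> i = 1"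
      using cards by (simp add: naimark_complement_inner[OF etf nc] etf_alpha_def of_nat_diff field_simps)
    then show ?thesis
      by (simp add: norm_eq_1)
  qed
  moreover obtain c where c: "\<And>i j. i \<noteq> j \<Longrightarrow> \<bar>\<phi> i \<bullet> \<phi> j\<bar> = c"
    using etf by (auto simp: etf_def)
  have "\<bar>\<psi> i \<bullet> \<psi> j\<bar> = \<bar>?b\<bar> * (c / \<bar>?a\<bar>)" if "i \<noteq> j" for i j
    using c[OF that] that by (simp add: naimark_complement_inner[OF etf nc] abs_mult)
  moreover have "?b > 0"
    by (simp add: etf_alpha_def)
  ultimately show ?thesis
    using naimark_complement_tight[OF nc] unfolding etf_def by blast
qed

text \<open>The all-ones vector is orthogonal to the rows of \<phi> and hence lies in the row space
  of \<psi>.\<close>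

lemma naimark_complement_axial:
  assumes "naimark_complement \<phi> \<psi>" "centered \<phi>"
  shows "axial \<psi>"
  using assms
  by (simp add: naimark_complement_def centered_def axial_def columns_transpose
      matrix_mult_eq_0_iff_orthogonal)

lemma naimark_complement_centered:
  assumes "naimark_complement \<phi> \<psi>" "axial \<phi>"
  shows "centered \<psi>"
  using assms
  by (simp add: naimark_complement_def centered_def axial_def columns_transpose
      matrix_mult_eq_0_iff_orthogonal orthogonal_comp_self)

text \<open>Off the diagonal the Gram entries of \<psi> are negative multiples of those of \<phi>.
  The latter are nonzero because \<beta> > 0, so adjacency is exactly reversed.\<close>

lemma naimark_complement_graph:
  fixes \<phi> :: "'n::finite \<Rightarrow> real^'m::finite" and \<psi> :: "'n \<Rightarrow> real^'k::finite"
  assumes lt: "CARD('m) < CARD('n)" and etf: "etf \<phi>" and nc: "naimark_complement \<phi> \<psi>"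
  shows "etf_graph \<psi> = graph_complement (etf_graph \<phi>)"
proof -
  let ?a = "etf_alpha CARD('m) CARD('n)" and ?b = "etf_alpha CARD('k) CARD('n)"
  have pos: "?a > 0" "?b > 0"
    by (simp_all add: etf_alpha_def)
  have "\<psi> i \<bullet> \<psi> j > 0 \<longleftrightarrow> \<not> \<phi> i \<bullet> \<phi> j > 0" if "i \<noteq> j" for i j
  proof -
    have "\<phi> i \<bullet> \<phi> j \<noteq> 0"
      using etf_inner[OF lt etf that] etf_beta_pos[OF lt] by force
    then show ?thesis
      using pos that
      by (auto simp: naimark_complement_inner[OF etf nc] mult_less_0_iff divide_less_0_iff)
  qed
  then show ?thesis
    by (auto simp: etf_graph_def graph_complement_def fun_eq_iff)
qed

theorem theorem4p2:
  fixes \<phi> :: "'n::finite \<Rightarrow> real^'m::finite"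
  assumes "CARD('m) < CARD('n)"
    and "etf \<phi>"
    and "centered \<phi> \<or> axial \<phi>"
  shows "\<exists>E v k l u.
      etf_matrix \<phi> = adjacency_matrix E \<and> srg E (v, k, l, u) \<and>
      v = 4 * k - 2 * l - 2 * u \<and>
      (centered \<phi> \<longrightarrow> (v, k, l, u) = centered_params CARD('m) CARD('n)) \<and>
      (axial \<phi> \<longrightarrow> (v, k, l, u) = axial_params CARD('m) CARD('n)) \<and>
      (\<forall>\<psi> :: 'n \<Rightarrow> real^'k::finite. naimark_complement \<phi> \<psi> \<longrightarrow>
         etf \<psi> \<and> (centered \<phi> \<longrightarrow> axial \<psi>) \<and> (axial \<phi> \<longrightarrow> centered \<psi>) \<and>
         (\<exists>E' v' k' l' u'.
            etf_matrix \<psi> = adjacency_matrix E' \<and> srg E' (v', k', l', u') \<and>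
            (centered \<psi> \<longrightarrow> (v', k', l', u') = centered_params CARD('k) CARD('n)) \<and>
            (axial \<psi> \<longrightarrow> (v', k', l', u') = axial_params CARD('k) CARD('n)) \<and>
            srg (graph_complement E) (complement_params (v, k, l, u)) \<and>
            complement_params (v, k, l, u) = (v', k', l', u')))"
proof -
  note lt = assms(1) and etf = assms(2)
  let ?a = "etf_alpha CARD('m) CARD('n)"
  obtain s where s: "gram \<phi> *v 1 = s *\<^sub>R 1"
    using assms(3) centered_gram axial_gram[OF etf] by (metis scaleR_zero_left)
  obtain v k l u where p: "etf_params CARD('m) CARD('n) s = (v, k, l, u)"
    by (metis prod_cases4)
  have complement: "etf \<psi> \<and> (centered \<phi> \<longrightarrow> axial \<psi>) \<and> (axial \<phi> \<longrightarrow> centered \<psi>) \<and>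
         (\<exists>E' v' k' l' u'.
            etf_matrix \<psi> = adjacency_matrix E' \<and> srg E' (v', k', l', u') \<and>
            (centered \<psi> \<longrightarrow> (v', k', l', u') = centered_params CARD('k) CARD('n)) \<and>
            (axial \<psi> \<longrightarrow> (v', k', l', u') = axial_params CARD('k) CARD('n)) \<and>
            srg (graph_complement (etf_graph \<phi>)) (complement_params (v, k, l, u)) \<and>
            complement_params (v, k, l, u) = (v', k', l', u'))"
    if nc: "naimark_complement \<phi> \<psi>" for \<psi> :: "'n \<Rightarrow> real^'k"
  proof -
    have etf': "etf \<psi>"
      by (rule naimark_complement_etf[OF etf nc])
    have k: "CARD('k) = CARD('n) - CARD('m)"
      using nc by (simp add: naimark_complement_def)
    then have lt': "CARD('k) < CARD('n)"
      by simp
    let ?s = "etf_alpha CARD('k) CARD('n) * (1 - s / ?a)"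
    have s': "gram \<psi> *v 1 = ?s *\<^sub>R 1"
      unfolding naimark_complement_gram[OF etf nc]
      by (simp add: scaleR_matrix_vector_assoc[symmetric] matrix_vector_mult_diff_rdistrib s
          algebra_simps)
    obtain v' k' l' u' where p': "etf_params CARD('k) CARD('n) ?s = (v', k', l', u')"
      by (metis prod_cases4)
    have c: "complement_params (v, k, l, u) = (v', k', l', u')"
      using complement_etf_params[OF lt, of s] p p' by (simp add: k)
    have E': "srg (etf_graph \<psi>) (v', k', l', u')"
      using srg_etf_graph[OF lt' etf' s'] by (simp only: p')
    \<comment> \<open>Strong regularity of the complement is inherited from the graph of \<psi>,
      which is the same graph with the same parameters.\<close>
    have "srg (graph_complement (etf_graph \<phi>)) (complement_params (v, k, l, u))"
      unfolding c naimark_complement_graph[OF lt etf nc, symmetric] by (rule E')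
    then show ?thesis
      using etf' c E' etf_matrix_eq_adjacency_matrix[OF lt' etf']
        etf_params_centered_axial[OF etf' s', unfolded p']
        naimark_complement_axial[OF nc] naimark_complement_centered[OF nc]
      by blast
  qed
  have "srg (etf_graph \<phi>) (v, k, l, u)"
    using srg_etf_graph[OF lt etf s] by (simp only: p)
  moreover have "v = 4 * k - 2 * l - 2 * u"
    by (rule etf_params_identity(5)[OF lt zero_less_card_finite p])
  ultimately show ?thesis
    using complement etf_matrix_eq_adjacency_matrix[OF lt etf]
      etf_params_centered_axial[OF etf s, unfolded p]
    by blast
qed

end
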